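(* Let $\mathcal B$ be a family of subsets of $[k]$ and let $p\in\{\mathrm{Split},\mathrm{Skew}\}$. If Player $p$ has a pairing strategy for $\mathcal B$, then $p$ has a winning strategy in the splitting game $(\ell,\mathcal B,t)$ for either value of $t\in\{\mathrm{Split},\mathrm{Skew}\}$ and for each integer $\ell \geq k$.
   Context: Let $[k]=\{1,\dots,k\}$. For $A,B\subseteq[k]$, $A$ splits $B$ if $|A\cap B|=|B|/2$ when $|B|$ is even, and $|A\cap B|\in\{(|B|-1)/2,(|B|+1)/2\}$ when $|B|$ is odd; $A$ splits a family (is a splitter of it) if it splits every member. The splitting game $(\ell,\mathcal B,t)$, where $\ell$ is a positive integer, $\mathcal B$ is a family of subsets of $[\ell]$ and $t\in\{\mathrm{Split},\mathrm{Skew}\}$ is the player who moves first: players Split and Skew alternately claim an element of $[\ell]$, without repetition, until all elements are claimed. Split wins if the set of elements Split claimed splits $\mathcal B$; otherwise Skew wins. For a family $\mathcal B$ of subsets of $[k]$: Split has a pairing strategy for $\mathcal B$ if there is a set $\mathcal P=\{P_1,\dots,P_r\}$ of disjoint pairs (two-element subsets) of elements of $[k]$ such that every splitter of $\mathcal P$ splits $\mathcal B$. Skew has a pairing strategy for $\mathcal B$ if there is such a $\mathcal P$ for which every splitter of $\mathcal P$ does not split $\mathcal B$. *)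

theory Defs
  imports Main
begin

definition splits :: "nat set \<Rightarrow> nat set \<Rightarrow> bool" where
  "splits A B \<longleftrightarrow>
     (if even (card B) then card (A \<inter> B) = card B div 2
      else card (A \<inter> B) \<in> {(card B - 1) div 2, (card B + 1) div 2})"

definition splitter :: "nat set \<Rightarrow> nat set set \<Rightarrow> bool" where
  "splitter A \<B> \<longleftrightarrow> (\<forall>B\<in>\<B>. splits A B)"

datatype player = Split | Skew

fun opponent :: "player \<Rightarrow> player" where
  "opponent Split = Skew"
| "opponent Skew = Split"

text \<open>A (partial) play is the list of claimed elements in chronological order; the move with
  index \<open>i\<close> (counting from 0) is made by \<open>mover t i\<close> if \<open>t\<close> moves first.\<close>

definition mover :: "player \<Rightarrow> nat \<Rightarrow> player" where
  "mover t i = (if even i then t else opponent t)"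

definition position :: "nat \<Rightarrow> nat list \<Rightarrow> bool" where
  "position l xs \<longleftrightarrow> distinct xs \<and> set xs \<subseteq> {1..l}"

definition complete_play :: "nat \<Rightarrow> nat list \<Rightarrow> bool" where
  "complete_play l xs \<longleftrightarrow> distinct xs \<and> set xs = {1..l}"

definition claimed :: "player \<Rightarrow> player \<Rightarrow> nat list \<Rightarrow> nat set" where
  "claimed t q xs = {xs ! i | i. i < length xs \<and> mover t i = q}"

fun wins :: "player \<Rightarrow> nat set set \<Rightarrow> player \<Rightarrow> nat list \<Rightarrow> bool" where
  "wins Split \<B> t xs \<longleftrightarrow> splitter (claimed t Split xs) \<B>"
| "wins Skew \<B> t xs \<longleftrightarrow> \<not> splitter (claimed t Split xs) \<B>"

text \<open>A strategy maps the history of the play to the next element to claim. Requiring a legal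
  move at every unfinished position where it is the player's turn guarantees that every
  strategy is followed by some complete play, so a winning strategy never wins vacuously.\<close>

definition legal_strategy :: "nat \<Rightarrow> player \<Rightarrow> player \<Rightarrow> (nat list \<Rightarrow> nat) \<Rightarrow> bool" where
  "legal_strategy l t p \<sigma> \<longleftrightarrow>
     (\<forall>xs. position l xs \<and> set xs \<noteq> {1..l} \<and> mover t (length xs) = p
        \<longrightarrow> \<sigma> xs \<in> {1..l} - set xs)"

definition follows :: "player \<Rightarrow> player \<Rightarrow> (nat list \<Rightarrow> nat) \<Rightarrow> nat list \<Rightarrow> bool" where
  "follows t p \<sigma> xs \<longleftrightarrow>
     (\<forall>i < length xs. mover t i = p \<longrightarrow> xs ! i = \<sigma> (take i xs))"

definition has_winning_strategy :: "player \<Rightarrow> nat \<Rightarrow> nat set set \<Rightarrow> player \<Rightarrow> bool" where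
  "has_winning_strategy p l \<B> t \<longleftrightarrow>
     (\<exists>\<sigma>. legal_strategy l t p \<sigma> \<and>
        (\<forall>xs. complete_play l xs \<and> follows t p \<sigma> xs \<longrightarrow> wins p \<B> t xs))"

definition disjoint_pairs :: "nat \<Rightarrow> nat set set \<Rightarrow> bool" where
  "disjoint_pairs k \<P> \<longleftrightarrow> (\<forall>P\<in>\<P>. P \<subseteq> {1..k} \<and> card P = 2) \<and> pairwise disjnt \<P>"

fun has_pairing_strategy :: "player \<Rightarrow> nat \<Rightarrow> nat set set \<Rightarrow> bool" where
  "has_pairing_strategy Split k \<B> \<longleftrightarrow>
     (\<exists>\<P>. disjoint_pairs k \<P> \<and> (\<forall>A\<subseteq>{1..k}. splitter A \<P> \<longrightarrow> splitter A \<B>))"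
| "has_pairing_strategy Skew k \<B> \<longleftrightarrow>
     (\<exists>\<P>. disjoint_pairs k \<P> \<and> (\<forall>A\<subseteq>{1..k}. splitter A \<P> \<longrightarrow> \<not> splitter A \<B>))"

end

theory Submission
  imports Defs
begin

text \<open>
  The player \<open>p\<close> who holds the pairing claims exactly one element of every pair; the opponent then
  also gets exactly one, so that the set claimed by Split splits the pairing whichever player \<open>p\<close>
  is. As all pairs and all members of \<open>\<B>\<close> lie in \<open>{1..k}\<close>, elements above \<open>k\<close> do not
  affect the outcome.

  The rule is: answer an element of an untouched pair by its partner; if there is nothing to
  answer, take an element outside all pairs, and only if none is left open an untouched pair.
  The last kind of move leaves a pair of which \<open>p\<close> owns one element while the other is still
  free. The danger is to be forced later to take this other element too. It never happens: the
  invariant \<open>safe\<close>, which holds whenever the opponent is to move, says that there is at most one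
  such pair and that then the elements outside the pairs are exhausted. So the opponent either
  takes the missing element, or breaks an untouched pair, which \<open>p\<close> can answer
  (\<open>safe_reply\<close>). If \<open>p\<close> begins, the first move is one with nothing to answer
  (\<open>safe_quiet_move\<close>). At the end, a pair that is not contained in the set of \<open>p\<close> meets that of
  the opponent, hence also that of \<open>p\<close>: it is divided evenly.
\<close>

section \<open>Positions that are safe for the owner of a pairing\<close>

text \<open>Sets \<open>M\<close> and \<open>N\<close> hold the elements claimed by the owner of the pairing and by the
  opponent.\<close>

definition ahead :: "'a set \<Rightarrow> 'a set \<Rightarrow> 'a set \<Rightarrow> bool" where
  "ahead M N P \<longleftrightarrow> P \<inter> M \<noteq> {} \<and> P \<inter> N = {}"

definition safe :: "'a set set \<Rightarrow> 'a set \<Rightarrow> 'a set \<Rightarrow> 'a set \<Rightarrow> bool" where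
  "safe \<P> S M N \<longleftrightarrow>
     (\<forall>P\<in>\<P>. P \<inter> N \<noteq> {} \<longrightarrow> P \<inter> M \<noteq> {}) \<and>
     (\<forall>P\<in>\<P>. \<not> P \<subseteq> M) \<and>
     (\<forall>P\<in>\<P>. \<forall>Q\<in>\<P>. ahead M N P \<longrightarrow> ahead M N Q \<longrightarrow> P = Q) \<and>
     (\<forall>P\<in>\<P>. ahead M N P \<longrightarrow> S - \<Union>\<P> \<subseteq> M \<union> N)"

lemma safeD:
  assumes "safe \<P> S M N" "P \<in> \<P>"
  shows "P \<inter> N \<noteq> {} \<Longrightarrow> P \<inter> M \<noteq> {}" "\<not> P \<subseteq> M"
    "Q \<in> \<P> \<Longrightarrow> ahead M N P \<Longrightarrow> ahead M N Q \<Longrightarrow> P = Q"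
    "ahead M N P \<Longrightarrow> S - \<Union>\<P> \<subseteq> M \<union> N"
  using assms unfolding safe_def by blast+

lemma pair_with_member:
  assumes "card P = 2" "x \<in> P"
  obtains y where "P = {x, y}" "y \<noteq> x"
proof -
  obtain a b where "P = {a, b}" "a \<noteq> b"
    using assms(1) by (auto simp: card_2_iff)
  with assms(2) that show thesis
    by (cases "x = a") auto
qed

lemma pairwise_disjnt_notin:
  "pairwise disjnt \<P> \<Longrightarrow> P \<in> \<P> \<Longrightarrow> Q \<in> \<P> \<Longrightarrow> P \<noteq> Q \<Longrightarrow> x \<in> Q \<Longrightarrow> x \<notin> P"
  by (meson pairwiseD disjnt_iff)

text \<open>When no pair is half taken, any element outside the pairs is harmless; if there is none, the
  free elements come in untouched pairs, and opening one of them creates the only pair in which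
  the owner is ahead.\<close>

lemma safe_quiet_move:
  assumes pairs: "\<And>P. P \<in> \<P> \<Longrightarrow> card P = 2" and disj: "pairwise disjnt \<P>"
    and answered: "\<And>P. P \<in> \<P> \<Longrightarrow> P \<inter> N \<noteq> {} \<Longrightarrow> P \<inter> M \<noteq> {}"
    and notfull: "\<And>P. P \<in> \<P> \<Longrightarrow> \<not> P \<subseteq> M"
    and level: "\<And>P. P \<in> \<P> \<Longrightarrow> \<not> ahead M N P"
    and MN: "M \<inter> N = {}"
    and free: "S - (M \<union> N) \<noteq> {}"
  shows "\<exists>x\<in>S - (M \<union> N). safe \<P> S (insert x M) N"
proof (cases "S - \<Union>\<P> \<subseteq> M \<union> N")
  case False
  then obtain u where u: "u \<in> S - (M \<union> N)" "u \<notin> \<Union>\<P>" by auto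
  then have same: "P \<inter> insert u M = P \<inter> M" "P \<subseteq> insert u M \<longleftrightarrow> P \<subseteq> M" if "P \<in> \<P>" for P
    using that by auto
  have "\<not> ahead (insert u M) N P" if "P \<in> \<P>" for P
    using level[OF that] same[OF that] unfolding ahead_def by simp
  then have "safe \<P> S (insert u M) N"
    unfolding safe_def using same answered notfull by simp
  with u show ?thesis by blast
next
  case True
  obtain x where x: "x \<in> S - (M \<union> N)" using free by auto
  then obtain Q where Q: "Q \<in> \<P>" "x \<in> Q" using True by auto
  obtain y where y: "Q = {x, y}" "y \<noteq> x"
    by (rule pair_with_member[OF pairs[OF Q(1)] Q(2)])
  have untouched: "y \<notin> M" "y \<notin> N"
    using answered[OF Q(1)] level[OF Q(1)] x MN unfolding ahead_def y by auto
  have other: "x \<notin> P" if "P \<in> \<P>" "P \<noteq> Q" for P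
    using pairwise_disjnt_notin[OF disj that(1) Q(1) that(2) Q(2)] .
  then have same: "P \<inter> insert x M = P \<inter> M" "P \<subseteq> insert x M \<longleftrightarrow> P \<subseteq> M"
    if "P \<in> \<P>" "P \<noteq> Q" for P
    using that by auto
  have only: "P = Q" if "P \<in> \<P>" "ahead (insert x M) N P" for P
    using same level that unfolding ahead_def by metis
  have "P \<inter> insert x M \<noteq> {}" if "P \<in> \<P>" "P \<inter> N \<noteq> {}" for P
    using answered[OF that] by blast
  moreover have "\<not> P \<subseteq> insert x M" if "P \<in> \<P>" for P
  proof (cases "P = Q")
    case False
    then show ?thesis using same(2) notfull that by simp
  qed (use untouched y in simp)
  moreover have "P = P'"
    if "P \<in> \<P>" "P' \<in> \<P>" "ahead (insert x M) N P" "ahead (insert x M) N P'" for P P'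
    using only[OF that(1,3)] only[OF that(2,4)] by simp
  moreover have "S - \<Union>\<P> \<subseteq> insert x M \<union> N" using True by blast
  ultimately have "safe \<P> S (insert x M) N"
    unfolding safe_def by simp
  with x show ?thesis by blast
qed

text \<open>The partner of the element \<open>z\<close> just taken by the opponent is the answer if it is free.
  Otherwise no pair is half taken any more: if the owner still were ahead in some pair, the
  elements outside the pairs would be exhausted, so \<open>z\<close> would lie in another pair; its partner,
  already claimed, would make the owner ahead in two pairs or the opponent unanswered.\<close>

lemma safe_reply:
  assumes pairs: "\<And>P. P \<in> \<P> \<Longrightarrow> card P = 2" and disj: "pairwise disjnt \<P>"
    and safe: "safe \<P> S M N"
    and MN: "M \<inter> N = {}"
    and z: "z \<in> S - (M \<union> N)"
    and free: "S - (M \<union> insert z N) \<noteq> {}"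
    and PS: "\<Union>\<P> \<subseteq> S"
  shows "\<exists>x\<in>S - (M \<union> insert z N). safe \<P> S (insert x M) (insert z N)"
proof (cases "\<exists>w. {z, w} \<in> \<P> \<and> w \<notin> M \<union> N")
  case True
  then obtain w where w: "{z, w} \<in> \<P>" "w \<notin> M \<union> N" by auto
  have wz: "w \<noteq> z" using pairs[OF w(1)] by auto
  have other: "z \<notin> P" "w \<notin> P" if "P \<in> \<P>" "P \<noteq> {z, w}" for P
    using pairwise_disjnt_notin[OF disj that(1) w(1) that(2)] by simp_all
  then have same: "P \<inter> insert w M = P \<inter> M" "P \<subseteq> insert w M \<longleftrightarrow> P \<subseteq> M" 
     "P \<inter> insert z N = P \<inter> N"
    if "P \<in> \<P>" "P \<noteq> {z, w}" for P
    using that by auto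
  have ahead: "ahead M N P" if "P \<in> \<P>" "ahead (insert w M) (insert z N) P" for P
  proof (cases "P = {z, w}")
    case True
    then show ?thesis using that(2) by (simp add: ahead_def)
  next
    case False
    then show ?thesis using that(2) same[OF that(1)] by (simp add: ahead_def)
  qed
  have "P \<inter> insert w M \<noteq> {}" if "P \<in> \<P>" "P \<inter> insert z N \<noteq> {}" for P
  proof (cases "P = {z, w}")
    case False
    then show ?thesis using that(2) same[OF that(1)] safeD(1)[OF safe that(1)] by simp
  qed simp
  moreover have "\<not> P \<subseteq> insert w M" if "P \<in> \<P>" for P
  proof (cases "P = {z, w}")
    case True
    then show ?thesis using z wz by simp
  next
    case False
    then show ?thesis using same[OF that] safeD(2)[OF safe that] by simp
  qed
  moreover have "P = Q"
    if "P \<in> \<P>" "Q \<in> \<P>" "ahead (insert w M) (insert z N) P" "ahead (insert w M) (insert z N) Q"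
    for P Q
    using safeD(3)[OF safe that(1,2)] ahead that by simp
  moreover have "S - \<Union>\<P> \<subseteq> insert w M \<union> insert z N"
    if "P \<in> \<P>" "ahead (insert w M) (insert z N) P" for P
    using safeD(4)[OF safe that(1) ahead[OF that]] by blast
  ultimately have "safe \<P> S (insert w M) (insert z N)"
    unfolding safe_def by simp
  moreover have "w \<in> S - (M \<union> insert z N)" using w wz PS by auto
  ultimately show ?thesis by blast
next
  case False
  have partner: "\<exists>w\<in>M. P = {z, w}" if P: "P \<in> \<P>" "z \<in> P" for P
  proof -
    obtain w where w: "P = {z, w}" "w \<noteq> z"
      by (rule pair_with_member[OF pairs[OF P(1)] P(2)])
    have "w \<in> M \<union> N" using False P(1) unfolding w(1) by blast
    moreover have "w \<in> M" if "w \<in> N"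
    proof -
      have "P \<inter> N \<noteq> {}" using that w(1) by blast
      then have "P \<inter> M \<noteq> {}" by (rule safeD(1)[OF safe P(1)])
      then show ?thesis using z w(1) by blast
    qed
    ultimately show ?thesis using w(1) by blast
  qed
  show ?thesis
  proof (rule safe_quiet_move[OF pairs disj])
    fix P assume P: "P \<in> \<P>"
    show "P \<inter> M \<noteq> {}" if "P \<inter> insert z N \<noteq> {}"
    proof (cases "z \<in> P")
      case True
      then show ?thesis using partner[OF P] by blast
    next
      case False
      then show ?thesis using that safeD(1)[OF safe P] by simp
    qed
    show "\<not> P \<subseteq> M" using safeD(2)[OF safe P] .
    show "\<not> ahead M (insert z N) P"
    proof
      assume a: "ahead M (insert z N) P"
      then have old: "ahead M N P" "z \<notin> P" unfolding ahead_def by auto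
      then have "S - \<Union>\<P> \<subseteq> M \<union> N" using safeD(4)[OF safe P] by simp
      then obtain R where R: "R \<in> \<P>" "z \<in> R" using z by auto
      then have "ahead M N R" using partner[OF R] MN z unfolding ahead_def by blast
      then have "R = P" using safeD(3)[OF safe R(1) P] old(1) by simp
      with R old show False by simp
    qed
  qed (use MN z free in auto)
qed

lemma safe_imp_one_each:
  assumes "safe \<P> S M N" "P \<in> \<P>" "card P = 2" "M \<inter> N = {}" "P \<subseteq> M \<union> N"
  shows "card (P \<inter> M) = 1 \<and> card (P \<inter> N) = 1"
proof -
  have 1: "P \<inter> M \<noteq> {}" "P \<inter> N \<noteq> {}"
    using safeD(1,2)[OF assms(1,2)] assms(5) by blast+
  have fin: "finite P" using assms(3) by (simp add: card_ge_0_finite)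
  have "card P = card (P \<inter> M) + card (P \<inter> N)"
    using card_Un_disjoint[of "P \<inter> M" "P \<inter> N"] assms(4,5) fin
    by (metis Int_Un_distrib Int_absorb2 finite_Int inf_assoc inf_left_commute inf_bot_right)
  moreover have "0 < card (P \<inter> M)" "0 < card (P \<inter> N)"
    using 1 fin by (simp_all add: card_gt_0_iff)
  ultimately show ?thesis using assms(3) by linarith
qed

text \<open>The opponent's last element may stay unanswered: it completes the pair in which the owner
  was ahead, or lies outside the pairs.\<close>

lemma safe_last_move_imp_one_each:
  assumes "safe \<P> S M N" "P \<in> \<P>" "card P = 2" "M \<inter> insert z N = {}" "z \<notin> N"
    "P \<subseteq> M \<union> insert z N"
  shows "card (P \<inter> M) = 1 \<and> card (P \<inter> insert z N) = 1"
proof (cases "z \<in> P")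
  case True
  obtain w where w: "P = {z, w}" "w \<noteq> z"
    by (rule pair_with_member[OF assms(3) True])
  have "w \<notin> N"
  proof
    assume "w \<in> N"
    then have "P \<inter> M \<noteq> {}" using safeD(1)[OF assms(1,2)] w(1) by simp
    then show False using assms(4) w(1) \<open>w \<in> N\<close> by auto
  qed
  then have "P \<inter> M = {w}" "P \<inter> insert z N = {z}" using assms(4,6) w by auto
  then show ?thesis by simp
next
  case False
  then have "P \<inter> insert z N = P \<inter> N" "P \<subseteq> M \<union> N" using assms(6) by auto
  then show ?thesis using safe_imp_one_each[of \<P> S M N P] assms by auto
qed

section \<open>Keeping to safe positions during the game\<close>

lemma opponent_neq [simp]: "opponent p \<noteq> p" "p \<noteq> opponent p"
  by (cases p; simp) (cases p; simp)

lemma player_neq_iff: "q \<noteq> p \<longleftrightarrow> q = opponent p"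
  by (cases p; cases q; simp)

lemma claimed_Nil [simp]: "claimed t q [] = {}"
  by (simp add: claimed_def)

lemma claimed_snoc [simp]:
  "claimed t q (xs @ [x]) =
     (if mover t (length xs) = q then insert x (claimed t q xs) else claimed t q xs)"
proof -
  have image: "claimed t q ys = (!) ys ` {i. i < length ys \<and> mover t i = q}" for ys
    unfolding claimed_def by blast
  have old: "(!) (xs @ [x]) ` {i. i < length xs \<and> mover t i = q} = claimed t q xs"
    unfolding image by (rule image_cong) (simp_all add: nth_append)
  have "{i. i < length (xs @ [x]) \<and> mover t i = q} =
      (if mover t (length xs) = q then insert (length xs) {i. i < length xs \<and> mover t i = q}
       else {i. i < length xs \<and> mover t i = q})"
    by (auto simp: less_Suc_eq)
  then show ?thesis unfolding image[of "xs @ [x]"] by (simp add: old)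
qed

lemma claimed_Un: "claimed t p xs \<union> claimed t (opponent p) xs = set xs"
  by (induction xs rule: rev_induct) (auto simp: player_neq_iff)

lemma claimed_disjoint:
  "distinct xs \<Longrightarrow> claimed t p xs \<inter> claimed t (opponent p) xs = {}"
proof (induction xs rule: rev_induct)
  case (snoc x xs)
  then show ?case using claimed_Un[of t p xs] by auto
qed simp

lemma mover_Suc: "mover t (Suc n) = opponent (mover t n)"
  by (cases t) (auto simp: mover_def)

lemma follows_snocD:
  assumes "follows t p \<sigma> (xs @ [x])"
  shows "follows t p \<sigma> xs" "mover t (length xs) = p \<Longrightarrow> x = \<sigma> xs"
proof -
  have step: "(xs @ [x]) ! i = \<sigma> (take i (xs @ [x]))"
    if "i < Suc (length xs)" "mover t i = p" for i
    using assms that unfolding follows_def by simp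
  show "follows t p \<sigma> xs"
    unfolding follows_def
  proof (intro allI impI)
    fix i assume "i < length xs" "mover t i = p"
    then show "xs ! i = \<sigma> (take i xs)" using step[of i] by (simp add: nth_append)
  qed
  show "mover t (length xs) = p \<Longrightarrow> x = \<sigma> xs" using step[of "length xs"] by simp
qed

text \<open>Because safety only depends on the position, the strategy may pick any legal move that
  leads to a safe position; elsewhere any legal move will do.\<close>

definition safe_strategy ::
    "nat set set \<Rightarrow> nat \<Rightarrow> player \<Rightarrow> player \<Rightarrow> nat list \<Rightarrow> nat" where
  "safe_strategy \<P> l t p xs =
     (let good = (\<lambda>x. x \<in> {1..l} - set xs \<and>
            safe \<P> {1..l} (insert x (claimed t p xs)) (claimed t (opponent p) xs))
      in if \<exists>x. good x then SOME x. good x else SOME x. x \<in> {1..l} - set xs)"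

lemma safe_strategy_safe:
  assumes "\<exists>x\<in>{1..l} - set xs.
             safe \<P> {1..l} (insert x (claimed t p xs)) (claimed t (opponent p) xs)"
  shows "safe_strategy \<P> l t p xs \<in> {1..l} - set xs \<and>
         safe \<P> {1..l} (insert (safe_strategy \<P> l t p xs) (claimed t p xs))
           (claimed t (opponent p) xs)"
proof -
  have ex: "\<exists>x. x \<in> {1..l} - set xs \<and>
      safe \<P> {1..l} (insert x (claimed t p xs)) (claimed t (opponent p) xs)"
    using assms by blast
  show ?thesis
    using someI_ex[OF ex] ex unfolding safe_strategy_def Let_def by (simp only: if_True)
qed

lemma legal_safe_strategy: "legal_strategy l t p (safe_strategy \<P> l t p)"
  unfolding legal_strategy_def
proof (intro allI impI)
  fix xs assume "position l xs \<and> set xs \<noteq> {1..l} \<and> mover t (length xs) = p"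
  then have ex: "\<exists>x. x \<in> {1..l} - set xs" unfolding position_def by blast
  show "safe_strategy \<P> l t p xs \<in> {1..l} - set xs"
  proof (cases "\<exists>x\<in>{1..l} - set xs.
      safe \<P> {1..l} (insert x (claimed t p xs)) (claimed t (opponent p) xs)")
    case True
    then show ?thesis using safe_strategy_safe by blast
  next
    case False
    then have "safe_strategy \<P> l t p xs = (SOME x. x \<in> {1..l} - set xs)"
      unfolding safe_strategy_def Let_def by (subst if_not_P) blast+
    then show ?thesis using someI_ex[OF ex] by simp
  qed
qed

text \<open>After an opponent's move safety is lost until the owner has replied, so on the owner's
  turn the invariant only promises a move to a safe position. In this form it also holds for the
  empty play when the owner begins.\<close>

lemma safe_strategy_invariant:
  assumes pairs: "\<And>P. P \<in> \<P> \<Longrightarrow> card P = 2" and disj: "pairwise disjnt \<P>"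
    and PS: "\<Union>\<P> \<subseteq> {1..l}"
    and "position l xs" "follows t p (safe_strategy \<P> l t p) xs"
  shows "if mover t (length xs) = p
         then set xs \<noteq> {1..l} \<longrightarrow> (\<exists>x\<in>{1..l} - set xs.
             safe \<P> {1..l} (insert x (claimed t p xs)) (claimed t (opponent p) xs))
         else safe \<P> {1..l} (claimed t p xs) (claimed t (opponent p) xs)"
  using assms(4,5)
proof (induction xs rule: rev_induct)
  case Nil
  have ne: "P \<noteq> {}" if "P \<in> \<P>" for P using pairs[OF that] by auto
  have "safe \<P> {1..l} {} {}" using ne unfolding safe_def ahead_def by auto
  moreover have "\<exists>x\<in>{1..l} - ({} \<union> {}). safe \<P> {1..l} (insert x {}) {}" if "{} \<noteq> {1..l}"
    by (rule safe_quiet_move[OF pairs disj]) (use ne that in \<open>auto simp: ahead_def\<close>)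
  ultimately show ?case by simp
next
  case (snoc z xs)
  let ?M = "claimed t p xs" and ?N = "claimed t (opponent p) xs"
  have pos: "position l xs" "distinct xs" and z: "z \<in> {1..l} - set xs"
    using snoc.prems(1) unfolding position_def by auto
  note IH = snoc.IH[OF pos(1) follows_snocD(1)[OF snoc.prems(2)]]
  have Un: "?M \<union> ?N = set xs" by (rule claimed_Un)
  have MN: "?M \<inter> ?N = {}" using pos(2) by (rule claimed_disjoint)
  show ?case
  proof (cases "mover t (length xs) = p")
    case True
    have "z = safe_strategy \<P> l t p xs" using follows_snocD(2)[OF snoc.prems(2) True] .
    moreover have "set xs \<noteq> {1..l}" using z by blast
    ultimately have "safe \<P> {1..l} (insert z ?M) ?N"
      using IH True safe_strategy_safe by auto
    then show ?thesis using True by (simp add: mover_Suc)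
  next
    case False
    then have mv: "mover t (length xs) = opponent p" by (simp add: player_neq_iff)
    have "\<exists>x\<in>{1..l} - (?M \<union> insert z ?N). safe \<P> {1..l} (insert x ?M) (insert z ?N)"
      if "set (xs @ [z]) \<noteq> {1..l}"
    proof (rule safe_reply[OF pairs disj _ MN _ _ PS])
      show "safe \<P> {1..l} ?M ?N" using IH False by simp
      show "z \<in> {1..l} - (?M \<union> ?N)" using z Un by simp
      show "{1..l} - (?M \<union> insert z ?N) \<noteq> {}"
        using that snoc.prems(1) Un unfolding position_def by auto
    qed
    moreover have "?M \<union> insert z ?N = set (xs @ [z])" using Un by auto
    moreover have "opponent (opponent p) = p" by (cases p) simp_all
    ultimately show ?thesis using mv by (simp add: mover_Suc del: set_append)
  qed
qed

lemma safe_strategy_one_each: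
  assumes pairs: "\<And>P. P \<in> \<P> \<Longrightarrow> card P = 2" and disj: "pairwise disjnt \<P>"
    and PS: "\<Union>\<P> \<subseteq> {1..l}"
    and play: "complete_play l xs" "follows t p (safe_strategy \<P> l t p) xs"
    and P: "P \<in> \<P>"
  shows "card (P \<inter> claimed t q xs) = 1"
proof -
  have pos: "position l xs" "distinct xs" "set xs = {1..l}"
    using play(1) unfolding complete_play_def position_def by auto
  have "P \<noteq> {}" using pairs[OF P] by auto
  then have "xs \<noteq> []" using pos(3) P PS by auto
  then obtain ys z where xs: "xs = ys @ [z]" by (metis rev_exhaust)
  have dis: "claimed t p xs \<inter> claimed t (opponent p) xs = {}"
    using pos(2) by (rule claimed_disjoint)
  have sub: "P \<subseteq> claimed t p xs \<union> claimed t (opponent p) xs"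
    using P PS pos(3) unfolding claimed_Un by blast
  have "card (P \<inter> claimed t p xs) = 1 \<and> card (P \<inter> claimed t (opponent p) xs) = 1"
  proof (cases "mover t (length ys) = p")
    case True
    then have "safe \<P> {1..l} (claimed t p xs) (claimed t (opponent p) xs)"
      using safe_strategy_invariant[OF pairs disj PS pos(1) play(2)]
      by (simp add: xs mover_Suc)
    then show ?thesis using safe_imp_one_each P pairs dis sub by blast
  next
    case False
    then have mv: "mover t (length ys) = opponent p" by (simp add: player_neq_iff)
    have "position l ys" using pos(1) unfolding xs position_def by auto
    then have "safe \<P> {1..l} (claimed t p ys) (claimed t (opponent p) ys)"
      using safe_strategy_invariant[OF pairs disj PS _ follows_snocD(1)] play(2) False xs
      by fastforce
    moreover have "z \<notin> claimed t (opponent p) ys"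
      using pos(2) claimed_Un[of t p ys] unfolding xs by auto
    ultimately show ?thesis
      using safe_last_move_imp_one_each[of \<P> _ "claimed t p ys" "claimed t (opponent p) ys" P z]
        P pairs dis sub mv unfolding xs by simp
  qed
  then show ?thesis by (cases "q = p") (auto simp: player_neq_iff)
qed

section \<open>Winning with a pairing\<close>

lemma splits_pair_iff: "card P = 2 \<Longrightarrow> splits A P \<longleftrightarrow> card (P \<inter> A) = 1"
  by (simp add: splits_def Int_commute)

lemma splitter_restrict:
  assumes "\<B> \<subseteq> Pow K"
  shows "splitter (A \<inter> K) \<B> \<longleftrightarrow> splitter A \<B>"
proof -
  have "A \<inter> K \<inter> B = A \<inter> B" if "B \<in> \<B>" for B using assms that by blast
  then show ?thesis by (simp add: splitter_def splits_def)
qed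

theorem lemma5p2:
  fixes k :: nat and \<B> :: "nat set set" and p :: player
  assumes "\<B> \<subseteq> Pow {1..k}"
    and "has_pairing_strategy p k \<B>"
  shows "\<forall>t. \<forall>l \<ge> k. 0 < l \<longrightarrow> has_winning_strategy p l \<B> t"
proof (intro allI impI)
  fix t l assume kl: "k \<le> l"
  obtain \<P> where \<P>: "disjoint_pairs k \<P>"
    and win: "\<And>A. A \<subseteq> {1..k} \<Longrightarrow> splitter A \<P> \<Longrightarrow> splitter A \<B> \<longleftrightarrow> p = Split"
    using assms(2) by (cases p) auto
  have pairs: "\<And>P. P \<in> \<P> \<Longrightarrow> card P = 2" and disj: "pairwise disjnt \<P>"
    and sub: "\<P> \<subseteq> Pow {1..k}"
    using \<P> unfolding disjoint_pairs_def by auto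
  have PS: "\<Union>\<P> \<subseteq> {1..l}" using sub kl by fastforce
  show "has_winning_strategy p l \<B> t"
    unfolding has_winning_strategy_def
  proof (intro exI[of _ "safe_strategy \<P> l t p"] conjI allI impI legal_safe_strategy)
    fix xs assume play: "complete_play l xs \<and> follows t p (safe_strategy \<P> l t p) xs"
    let ?A = "claimed t Split xs"
    have "splitter ?A \<P>"
      using safe_strategy_one_each[OF pairs disj PS] play
      by (auto simp: splitter_def splits_pair_iff pairs)
    then have "splitter ?A \<B> \<longleftrightarrow> p = Split"
      using win[of "?A \<inter> {1..k}"] splitter_restrict[OF sub] splitter_restrict[OF assms(1)]
      by simp
    then show "wins p \<B> t xs" by (cases p) simp_all
  qed
qed

end
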